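(* Let $M$ be a lattice of finite rank with dual lattice $N$, let $\sigma\subset N_{\mathbb{Q}}$ be a strongly convex rational polyhedral cone with dual cone $\sigma^\vee\subset M_{\mathbb{Q}}$, and let $X=\operatorname{Spec}(A)$ with $A=\bigoplus_{u\in\sigma^\vee\cap M}\mathbb{C}\cdot\chi^u$ be the corresponding affine toric variety with torus $T=\operatorname{Spec}\mathbb{C}[M]$. Let $\{u_1,\dots,u_k\}$ be a minimal generating set of $\sigma^\vee\cap M$ and let $$S=\Big\{\sum_{i=1}^k\alpha_iu_i : \alpha_i\in\{0,1\}\Big\},$$ where for $v,w\in S$ one writes $v\geq w$ if $X^{ss}(v)\subset X^{ss}(w)$. Then for every $v\in S$ the GIT-cone $\lambda_T(v)$ is the cone generated by the set $\{u_i : v\geq u_i\}$.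
   Context: For an $M$-graded algebra $A=\bigoplus_{u\in M}A_u$ and $X=\operatorname{Spec}(A)$ with the induced action of $T=\operatorname{Spec}\mathbb{C}[M]$: - The set of semistable points of $u\in M$ is $X^{ss}(u)=\bigcup_{n\in\mathbb{Z}_{>0},\,f\in A_{nu}}X_f$, where $X_f=\{x\in X: f(x)\neq0\}$. - The orbit monoid of $x\in X$ is the submonoid $S_T(x)\subset M$ of all $u\in M$ admitting $f\in A_u$ with $f(x)\neq0$; the orbit cone $\omega_T(x)\subset M_{\mathbb{Q}}$ is the convex cone generated by $S_T(x)$. - The weight cone $\omega\subset M_{\mathbb{Q}}$ is the cone generated by all $u\in M$ with $A_u\neq\{0\}$ (here $\omega=\sigma^\vee$). The GIT-cone $\lambda_T(u)$ of $u\in\omega\cap M$ is the intersection of all orbit cones $\omega_T(x)$, $x\in X$, containing $u$. *)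

theory Defs
  imports
    Complex_Main
    "HOL-Library.Poly_Mapping"
    "HOL-Library.Function_Algebras"
    "HOL-Algebra.QuotRing"
begin

section \<open>Lattices and rational cones\<close>

text \<open>
  A lattice \<open>M\<close> is given inside the rational vector space \<open>M\<^sub>\<rat>\<close>, which is the whole type
  \<open>'v\<close> with scalar multiplication \<open>scale\<close>. The basis may be empty (rank zero).
\<close>

definition lattice_in :: "(rat \<Rightarrow> 'v::ab_group_add \<Rightarrow> 'v) \<Rightarrow> 'v set \<Rightarrow> bool" where
  "lattice_in scale M \<longleftrightarrow>
     (\<exists>B. finite_dimensional_vector_space scale B \<and>
          M = {\<Sum>b\<in>B. scale (of_int (c b)) b | c :: 'v \<Rightarrow> int. True})"

definition convex_cone_gen :: "(rat \<Rightarrow> 'v::ab_group_add \<Rightarrow> 'v) \<Rightarrow> 'v set \<Rightarrow> 'v set" where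
  "convex_cone_gen scale S =
     {\<Sum>s\<in>F. scale (c s) s | F (c :: 'v \<Rightarrow> rat). finite F \<and> F \<subseteq> S \<and> (\<forall>s\<in>F. 0 \<le> c s)}"

text \<open>
  \<open>N\<^sub>\<rat>\<close> is the space of rational linear functionals on \<open>M\<^sub>\<rat>\<close>, with pointwise operations, and
  \<open>N = Hom(M, \<int>)\<close> consists of the functionals that are integral on \<open>M\<close>.
\<close>

definition dual_lattice ::
  "(rat \<Rightarrow> 'v::ab_group_add \<Rightarrow> 'v) \<Rightarrow> 'v set \<Rightarrow> ('v \<Rightarrow> rat) set" where
  "dual_lattice scale M = {l. Vector_Spaces.linear scale (*) l \<and> (\<forall>m\<in>M. l m \<in> \<int>)}"

definition scale_fun :: "rat \<Rightarrow> ('v \<Rightarrow> rat) \<Rightarrow> 'v \<Rightarrow> rat" where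
  "scale_fun c l = (\<lambda>x. c * l x)"

definition rational_polyhedral_cone ::
  "(rat \<Rightarrow> 'v::ab_group_add \<Rightarrow> 'v) \<Rightarrow> 'v set \<Rightarrow> ('v \<Rightarrow> rat) set \<Rightarrow> bool" where
  "rational_polyhedral_cone scale M \<sigma> \<longleftrightarrow>
     (\<exists>G. finite G \<and> G \<subseteq> dual_lattice scale M \<and> \<sigma> = convex_cone_gen scale_fun G)"

definition strongly_convex :: "('v \<Rightarrow> rat) set \<Rightarrow> bool" where
  "strongly_convex \<sigma> \<longleftrightarrow> \<sigma> \<inter> uminus ` \<sigma> = {0}"

definition dual_cone :: "('v \<Rightarrow> rat) set \<Rightarrow> 'v set" where
  "dual_cone \<sigma> = {u. \<forall>l\<in>\<sigma>. 0 \<le> l u}"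

inductive_set submonoid_gen :: "'v::ab_group_add set \<Rightarrow> 'v set" for G where
  zero: "0 \<in> submonoid_gen G"
| add: "g \<in> G \<Longrightarrow> x \<in> submonoid_gen G \<Longrightarrow> g + x \<in> submonoid_gen G"

definition minimal_generating_set :: "'v::ab_group_add set \<Rightarrow> 'v set \<Rightarrow> bool" where
  "minimal_generating_set G Q \<longleftrightarrow>
     submonoid_gen G = Q \<and> (\<forall>H. H \<subset> G \<longrightarrow> submonoid_gen H \<noteq> Q)"

section \<open>Spectra of graded rings\<close>

definition Spec :: "('a, 'r) ring_scheme \<Rightarrow> 'a set set" where
  "Spec R = {x. primeideal x R}"

text \<open>
  The value \<open>f(x)\<close> is the class of \<open>f\<close> in \<open>R/x\<close>, a subring of the residue field of \<open>x\<close>.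
\<close>

definition principal_open :: "('a, 'r) ring_scheme \<Rightarrow> 'a \<Rightarrow> 'a set set" where
  "principal_open R f = {x \<in> Spec R. x +>\<^bsub>R\<^esub> f \<noteq> \<zero>\<^bsub>R Quot x\<^esub>}"

text \<open>In the following, \<open>gr u\<close> is the homogeneous component of degree \<open>u\<close> of \<open>R\<close>.\<close>

definition semistable ::
  "('a, 'r) ring_scheme \<Rightarrow> (rat \<Rightarrow> 'v::ab_group_add \<Rightarrow> 'v) \<Rightarrow> ('v \<Rightarrow> 'a set) \<Rightarrow> 'v \<Rightarrow> 'a set set"
where
  "semistable R scale gr u =
     (\<Union>n\<in>{n::nat. 0 < n}. \<Union>f\<in>gr (scale (of_nat n) u). principal_open R f)"

definition orbit_monoid ::
  "('a, 'r) ring_scheme \<Rightarrow> 'v set \<Rightarrow> ('v \<Rightarrow> 'a set) \<Rightarrow> 'a set \<Rightarrow> 'v set" where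
  "orbit_monoid R M gr x = {u \<in> M. \<exists>f\<in>gr u. x \<in> principal_open R f}"

definition orbit_cone ::
  "('a, 'r) ring_scheme \<Rightarrow> (rat \<Rightarrow> 'v::ab_group_add \<Rightarrow> 'v) \<Rightarrow> 'v set \<Rightarrow> ('v \<Rightarrow> 'a set) \<Rightarrow>
   'a set \<Rightarrow> 'v set"
where
  "orbit_cone R scale M gr x = convex_cone_gen scale (orbit_monoid R M gr x)"

definition git_cone ::
  "('a, 'r) ring_scheme \<Rightarrow> (rat \<Rightarrow> 'v::ab_group_add \<Rightarrow> 'v) \<Rightarrow> 'v set \<Rightarrow> ('v \<Rightarrow> 'a set) \<Rightarrow>
   'v \<Rightarrow> 'v set"
where
  "git_cone R scale M gr u =
     \<Inter>{orbit_cone R scale M gr x | x. x \<in> Spec R \<and> u \<in> orbit_cone R scale M gr x}"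

section \<open>Affine toric varieties\<close>

text \<open>
  The monoid algebra \<open>\<complex>[Q]\<close> of a submonoid \<open>Q\<close>: finitely supported functions with convolution
  as product, the character \<open>\<chi>\<^sup>u\<close> being \<open>Poly_Mapping.single u 1\<close>.
\<close>

definition monoid_algebra :: "'v::ab_group_add set \<Rightarrow> ('v \<Rightarrow>\<^sub>0 complex) ring" where
  "monoid_algebra Q =
     \<lparr>carrier = {f. Poly_Mapping.keys f \<subseteq> Q}, mult = (*), one = 1, zero = 0, add = (+)\<rparr>"

definition monoid_algebra_grading :: "'v::ab_group_add set \<Rightarrow> 'v \<Rightarrow> ('v \<Rightarrow>\<^sub>0 complex) set" where
  "monoid_algebra_grading Q u =
     (if u \<in> Q then {Poly_Mapping.single u a | a. True} else {0})"

definition toric_algebra :: "'v::ab_group_add set \<Rightarrow> ('v \<Rightarrow> rat) set \<Rightarrow> ('v \<Rightarrow>\<^sub>0 complex) ring" where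
  "toric_algebra M \<sigma> = monoid_algebra (dual_cone \<sigma> \<inter> M)"

definition toric_grading ::
  "'v::ab_group_add set \<Rightarrow> ('v \<Rightarrow> rat) set \<Rightarrow> 'v \<Rightarrow> ('v \<Rightarrow>\<^sub>0 complex) set" where
  "toric_grading M \<sigma> = monoid_algebra_grading (dual_cone \<sigma> \<inter> M)"

lemma cring_monoid_algebra:
  assumes "0 \<in> Q" and "\<And>u v. u \<in> Q \<Longrightarrow> v \<in> Q \<Longrightarrow> u + v \<in> Q"
  shows "cring (monoid_algebra Q)"
proof -
  have mult: "Poly_Mapping.keys (f * g) \<subseteq> Q"
    if "Poly_Mapping.keys f \<subseteq> Q" "Poly_Mapping.keys g \<subseteq> Q" for f g :: "'a \<Rightarrow>\<^sub>0 complex"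
    using keys_mult[of f g] that assms(2) by blast
  have add: "Poly_Mapping.keys (f + g) \<subseteq> Q"
    if "Poly_Mapping.keys f \<subseteq> Q" "Poly_Mapping.keys g \<subseteq> Q" for f g :: "'a \<Rightarrow>\<^sub>0 complex"
    using Poly_Mapping.keys_add[of f g] that by blast
  have neg: "\<exists>g. Poly_Mapping.keys g \<subseteq> Q \<and> g + f = 0"
    if "Poly_Mapping.keys f \<subseteq> Q" for f :: "'a \<Rightarrow>\<^sub>0 complex"
    using that by (intro exI[of _ "- f"]) simp
  show ?thesis
    unfolding monoid_algebra_def
    by (intro cringI abelian_groupI comm_monoidI)
       (use assms(1) mult add neg in \<open>auto simp: algebra_simps\<close>)
qed

text \<open>The order on weights: \<open>v \<ge> w\<close> iff \<open>X\<^sup>s\<^sup>s(v) \<subseteq> X\<^sup>s\<^sup>s(w)\<close>, for \<open>X\<close> the affine toric variety.\<close>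

definition toric_weight_ge ::
  "(rat \<Rightarrow> 'v::ab_group_add \<Rightarrow> 'v) \<Rightarrow> 'v set \<Rightarrow> ('v \<Rightarrow> rat) set \<Rightarrow> 'v \<Rightarrow> 'v \<Rightarrow> bool" where
  "toric_weight_ge scale M \<sigma> v w \<longleftrightarrow>
     semistable (toric_algebra M \<sigma>) scale (toric_grading M \<sigma>) v
       \<subseteq> semistable (toric_algebra M \<sigma>) scale (toric_grading M \<sigma>) w"

end

theory Submission
  imports Defs
begin

text \<open>
  Write \<open>Q = \<sigma>\<^sup>\<or> \<inter> M\<close>. Everything that the \<open>M\<close>-grading sees of a point \<open>x\<close> of
  \<open>X = Spec \<complex>[Q]\<close> is the set of characters that do not vanish at \<open>x\<close>. Because \<open>x\<close> is prime, this
  set is a face of the monoid \<open>Q\<close>: a sum of two weights lies in it iff both summands do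
  (\<open>monoid_face_nonvanishing\<close>). Conversely every face \<open>F\<close> occurs, at the distinguished point of the
  corresponding torus orbit: the indicator function of \<open>F\<close> is a homomorphism from \<open>Q\<close> to the
  multiplicative monoid \<open>\<complex>\<close>, and the kernel of the induced evaluation \<open>\<complex>[Q] \<rightarrow> \<complex>\<close> is the required
  prime (\<open>face_attained\<close>).

  In these terms, for \<open>v \<in> Q\<close>, the point \<open>x\<close> is semistable for \<open>v\<close> iff \<open>v\<close> lies in the face of \<open>x\<close>,
  and the orbit cone of \<open>x\<close> is the cone over that face. Faces absorb roots (if \<open>n v \<in> F\<close> with
  \<open>n > 0\<close> then \<open>v \<in> F\<close>), so an element of \<open>Q\<close> in the rational cone over a face is already in
  the face. Hence both sides of the theorem are governed by the smallest face \<open>F\<^sub>v\<close> containing \<open>v\<close>: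
  the GIT-cone of \<open>v\<close> is the cone over \<open>F\<^sub>v\<close>, since \<open>F\<^sub>v\<close> is one of the faces in the
  intersection and is contained in the others; and \<open>v \<ge> w\<close> means \<open>w \<in> F\<^sub>v\<close>. Finally, a face
  of a monoid is generated by those generators of the monoid that it contains, so the cone over
  \<open>F\<^sub>v\<close> is generated by the \<open>u\<^sub>i \<in> F\<^sub>v\<close>.
\<close>

section \<open>Rational cones\<close>

lemma generator_in_convex_cone_gen:
  assumes "vector_space scale" and "s \<in> S"
  shows "s \<in> convex_cone_gen scale S"
proof -
  interpret vector_space scale by fact
  show ?thesis
    unfolding convex_cone_gen_def
    by (intro CollectI exI[of _ "{s}"] exI[of _ "\<lambda>_. 1"]) (use assms(2) in simp)
qed

lemma zero_in_convex_cone_gen: "0 \<in> convex_cone_gen scale S"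
  unfolding convex_cone_gen_def by (intro CollectI exI[of _ "{}"]) simp

lemma convex_cone_gen_scale:
  assumes "vector_space scale" and "x \<in> convex_cone_gen scale S" and "0 \<le> r"
  shows "scale r x \<in> convex_cone_gen scale S"
proof -
  interpret vector_space scale by fact
  obtain F c where F: "finite F" "F \<subseteq> S" "\<forall>s\<in>F. 0 \<le> c s" "x = (\<Sum>s\<in>F. scale (c s) s)"
    using assms(2) unfolding convex_cone_gen_def by blast
  have "scale r x = (\<Sum>s\<in>F. scale (r * c s) s)"
    by (simp add: F(4) scale_sum_right)
  with F(1-3) assms(3) show ?thesis
    unfolding convex_cone_gen_def
    by (intro CollectI exI[of _ F] exI[of _ "\<lambda>s. r * c s"]) simp
qed

lemma convex_cone_gen_add:
  assumes "vector_space scale"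
    and "x \<in> convex_cone_gen scale S" and "y \<in> convex_cone_gen scale S"
  shows "x + y \<in> convex_cone_gen scale S"
proof -
  interpret vector_space scale by fact
  obtain F c where F: "finite F" "F \<subseteq> S" "\<forall>s\<in>F. 0 \<le> c s" "x = (\<Sum>s\<in>F. scale (c s) s)"
    using assms(2) unfolding convex_cone_gen_def by blast
  obtain G d where G: "finite G" "G \<subseteq> S" "\<forall>s\<in>G. 0 \<le> d s" "y = (\<Sum>s\<in>G. scale (d s) s)"
    using assms(3) unfolding convex_cone_gen_def by blast
  define c' where "c' s = (if s \<in> F then c s else 0)" for s
  define d' where "d' s = (if s \<in> G then d s else 0)" for s
  have "x = (\<Sum>s\<in>F \<union> G. scale (c' s) s)"
    unfolding F(4) by (rule sum.mono_neutral_cong_left) (auto simp: c'_def F(1) G(1))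
  moreover have "y = (\<Sum>s\<in>F \<union> G. scale (d' s) s)"
    unfolding G(4) by (rule sum.mono_neutral_cong_left) (auto simp: d'_def F(1) G(1))
  ultimately have "x + y = (\<Sum>s\<in>F \<union> G. scale (c' s + d' s) s)"
    by (simp add: sum.distrib scale_left_distrib)
  moreover have "\<forall>s\<in>F \<union> G. 0 \<le> c' s + d' s"
    using F(3) G(3) by (auto simp: c'_def d'_def)
  ultimately show ?thesis
    unfolding convex_cone_gen_def using F(1,2) G(1,2)
    by (intro CollectI exI[of _ "F \<union> G"] exI[of _ "\<lambda>s. c' s + d' s"]) simp
qed

lemma convex_cone_gen_least:
  assumes "S \<subseteq> C" and "0 \<in> C"
    and add: "\<And>x y. x \<in> C \<Longrightarrow> y \<in> C \<Longrightarrow> x + y \<in> C"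
    and scale: "\<And>r x. 0 \<le> r \<Longrightarrow> x \<in> C \<Longrightarrow> scale r x \<in> C"
  shows "convex_cone_gen scale S \<subseteq> C"
proof
  fix x
  assume "x \<in> convex_cone_gen scale S"
  then obtain F c where F: "finite F" "F \<subseteq> S" "\<forall>s\<in>F. 0 \<le> c s" "x = (\<Sum>s\<in>F. scale (c s) s)"
    unfolding convex_cone_gen_def by blast
  from F(1-3) have "(\<Sum>s\<in>F. scale (c s) s) \<in> C"
    by (induction F) (use assms in auto)
  with F(4) show "x \<in> C" by simp
qed

lemma convex_cone_gen_mono:
  "S \<subseteq> T \<Longrightarrow> convex_cone_gen scale S \<subseteq> convex_cone_gen scale T"
  unfolding convex_cone_gen_def by blast

section \<open>Submonoids and their faces\<close>

definition additive_submonoid :: "'v::ab_group_add set \<Rightarrow> bool" where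
  "additive_submonoid Q \<longleftrightarrow> 0 \<in> Q \<and> (\<forall>a\<in>Q. \<forall>b\<in>Q. a + b \<in> Q)"

definition monoid_face :: "'v::ab_group_add set \<Rightarrow> 'v set \<Rightarrow> bool" where
  "monoid_face Q F \<longleftrightarrow>
     F \<subseteq> Q \<and> 0 \<in> F \<and> (\<forall>a\<in>Q. \<forall>b\<in>Q. a + b \<in> F \<longleftrightarrow> a \<in> F \<and> b \<in> F)"

definition smallest_face :: "'v::ab_group_add set \<Rightarrow> 'v \<Rightarrow> 'v set" where
  "smallest_face Q v = \<Inter>{F. monoid_face Q F \<and> v \<in> F}"

lemma additive_submonoid_gen: "additive_submonoid (submonoid_gen G)"
proof -
  have "a + b \<in> submonoid_gen G" if "a \<in> submonoid_gen G" "b \<in> submonoid_gen G" for a b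
    using that by (induction) (auto simp: add.assoc intro: submonoid_gen.add)
  then show ?thesis
    unfolding additive_submonoid_def by (blast intro: submonoid_gen.zero)
qed

lemma generator_in_submonoid_gen: "g \<in> G \<Longrightarrow> g \<in> submonoid_gen G"
  using submonoid_gen.add[OF _ submonoid_gen.zero] by force

lemma monoid_face_self: "additive_submonoid Q \<Longrightarrow> monoid_face Q Q"
  unfolding additive_submonoid_def monoid_face_def by blast

lemma monoid_face_smallest_face:
  assumes "additive_submonoid Q" and "v \<in> Q"
  shows "monoid_face Q (smallest_face Q v)"
proof -
  have "smallest_face Q v \<subseteq> Q"
    using monoid_face_self[OF assms(1)] assms(2) unfolding smallest_face_def by blast
  then show ?thesis
    unfolding monoid_face_def smallest_face_def by auto
qed

lemma mem_smallest_face: "v \<in> smallest_face Q v"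
  unfolding smallest_face_def by blast

lemma smallest_face_subset: "monoid_face Q F \<Longrightarrow> v \<in> F \<Longrightarrow> smallest_face Q v \<subseteq> F"
  unfolding smallest_face_def by blast

lemma submonoid_face:
  assumes "monoid_face Q F"
  shows "additive_submonoid F"
  using assms unfolding monoid_face_def additive_submonoid_def by blast

lemma submonoid_scale_nat:
  assumes "vector_space scale" and "additive_submonoid Q" and "a \<in> Q"
  shows "scale (of_nat n) a \<in> Q"
proof -
  interpret vector_space scale by fact
  show ?thesis
    by (induction n) (use assms(2,3) in \<open>auto simp: additive_submonoid_def scale_left_distrib\<close>)
qed

lemma monoid_face_scale_nat_iff:
  assumes "vector_space scale" and "additive_submonoid Q" and "monoid_face Q F"
    and "a \<in> Q" and "0 < n"
  shows "scale (of_nat n) a \<in> F \<longleftrightarrow> a \<in> F"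
proof -
  interpret vector_space scale by fact
  obtain m where "n = Suc m" using \<open>0 < n\<close> by (cases n) auto
  then have "scale (of_nat n) a = a + scale (of_nat m) a"
    by (simp add: scale_left_distrib)
  moreover have "scale (of_nat m) a \<in> Q"
    using submonoid_scale_nat assms(1,2,4) by blast
  moreover have "scale (of_nat m) a \<in> F" if "a \<in> F"
    using submonoid_scale_nat assms(1) submonoid_face[OF assms(3)] that by blast
  ultimately show ?thesis
    using assms(3,4) unfolding monoid_face_def by metis
qed

text \<open>
  Clearing denominators in a nonnegative rational combination yields a nonnegative integral one.
  The proof avoids a common denominator for a whole sum: the set of vectors with a positive multiple
  in \<open>F\<close> is itself a rational convex cone containing \<open>F\<close>.
\<close>

lemma multiple_in_submonoid:
  assumes "vector_space scale" and "additive_submonoid F" and "v \<in> convex_cone_gen scale F"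
  shows "\<exists>n>0. scale (of_nat n) v \<in> F"
proof -
  interpret vector_space scale by fact
  let ?C = "{v. \<exists>n>0. scale (of_nat n) v \<in> F}"
  have nat: "scale (of_nat n) a \<in> F" if "a \<in> F" for n a
    using submonoid_scale_nat[OF assms(1,2) that] .
  have "convex_cone_gen scale F \<subseteq> ?C"
  proof (rule convex_cone_gen_least)
    show "F \<subseteq> ?C"
      by (auto intro: exI[of _ 1])
    show "0 \<in> ?C"
      using assms(2) by (auto simp: additive_submonoid_def intro: exI[of _ 1])
  next
    fix x y assume "x \<in> ?C" and "y \<in> ?C"
    then obtain m n where mn: "m > 0" "scale (of_nat m) x \<in> F" "n > 0" "scale (of_nat n) y \<in> F"
      by blast
    have "scale (of_nat (m * n)) (x + y)
        = scale (of_nat n) (scale (of_nat m) x) + scale (of_nat m) (scale (of_nat n) y)"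
      by (simp add: scale_right_distrib mult.commute)
    also have "\<dots> \<in> F"
      using nat mn assms(2) unfolding additive_submonoid_def by blast
    finally show "x + y \<in> ?C"
      using mn(1,3) by (intro CollectI exI[of _ "m * n"]) simp
  next
    fix r :: rat and x assume "0 \<le> r" and "x \<in> ?C"
    then obtain m where m: "m > 0" "scale (of_nat m) x \<in> F" by blast
    obtain p q where "quotient_of r = (p, q)" by fastforce
    then have pq: "r = of_int p / of_int q" "q > 0"
      by (rule quotient_of_div, rule quotient_of_denom_pos)
    have "0 \<le> p"
      using \<open>0 \<le> r\<close> pq by (simp add: zero_le_divide_iff)
    then have r: "r * of_nat (nat q) = of_nat (nat p)"
      using pq by simp
    have "scale (of_nat (nat q * m)) (scale r x) = scale (of_nat (nat p)) (scale (of_nat m) x)"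
      by (simp add: r[symmetric] mult_ac del: of_nat_nat)
    also have "\<dots> \<in> F"
      using nat m(2) by blast
    finally show "scale r x \<in> ?C"
      using m(1) pq(2) by (intro CollectI exI[of _ "nat q * m"]) simp
  qed
  with assms(3) show ?thesis by blast
qed

lemma mem_convex_cone_gen_face_iff:
  assumes "vector_space scale" and "additive_submonoid Q" and "monoid_face Q F" and "v \<in> Q"
  shows "v \<in> convex_cone_gen scale F \<longleftrightarrow> v \<in> F"
  using multiple_in_submonoid[OF assms(1) submonoid_face[OF assms(3)]]
    monoid_face_scale_nat_iff[OF assms] generator_in_convex_cone_gen[OF assms(1)]
  by blast

text \<open>
  A decomposition of an element of a face into generators stays in the face, since faces are closed
  under taking summands.
\<close>

lemma convex_cone_gen_face:
  assumes "vector_space scale" and "monoid_face (submonoid_gen G) F"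
  shows "convex_cone_gen scale F = convex_cone_gen scale (G \<inter> F)"
proof
  have "w \<in> F \<longrightarrow> w \<in> convex_cone_gen scale (G \<inter> F)" if "w \<in> submonoid_gen G" for w
    using that
  proof induction
    case zero
    show ?case by (simp add: zero_in_convex_cone_gen)
  next
    case (add g x)
    then have "g + x \<in> F \<longleftrightarrow> g \<in> F \<and> x \<in> F"
      using assms(2) generator_in_submonoid_gen unfolding monoid_face_def by blast
    with add show ?case
      using convex_cone_gen_add[OF assms(1)] generator_in_convex_cone_gen[OF assms(1)] by blast
  qed
  then have "F \<subseteq> convex_cone_gen scale (G \<inter> F)"
    using assms(2) unfolding monoid_face_def by blast
  then show "convex_cone_gen scale F \<subseteq> convex_cone_gen scale (G \<inter> F)"
    using zero_in_convex_cone_gen convex_cone_gen_add[OF assms(1)]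
      convex_cone_gen_scale[OF assms(1)]
    by (rule convex_cone_gen_least)
  show "convex_cone_gen scale (G \<inter> F) \<subseteq> convex_cone_gen scale F"
    by (rule convex_cone_gen_mono) simp
qed

section \<open>Points of the spectrum of a monoid algebra\<close>

definition nonvanishing_weights :: "'v::ab_group_add set \<Rightarrow> ('v \<Rightarrow>\<^sub>0 complex) set \<Rightarrow> 'v set" where
  "nonvanishing_weights Q x = {w \<in> Q. Poly_Mapping.single w 1 \<notin> x}"

lemma cring_monoid_algebra_submonoid: "additive_submonoid Q \<Longrightarrow> cring (monoid_algebra Q)"
  by (rule cring_monoid_algebra) (auto simp: additive_submonoid_def)

lemma mem_principal_open_iff:
  assumes "x \<in> Spec R" and "f \<in> carrier R"
  shows "x \<in> principal_open R f \<longleftrightarrow> f \<notin> x"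
proof -
  interpret primeideal x R using assms(1) by (simp add: Spec_def)
  have "x +>\<^bsub>R\<^esub> f = x \<longleftrightarrow> f \<in> x"
    using a_rcos_self[OF assms(2)] a_rcos_const by metis
  then show ?thesis
    using assms(1) by (simp add: principal_open_def FactRing_def)
qed

text \<open>
  Nonzero homogeneous elements are nonzero scalar multiples of characters, and such scalars are
  units.
\<close>

lemma exists_homogeneous_nonvanishing_iff:
  assumes "additive_submonoid Q" and "x \<in> Spec (monoid_algebra Q)"
  shows "(\<exists>f\<in>monoid_algebra_grading Q w. x \<in> principal_open (monoid_algebra Q) f)
         \<longleftrightarrow> w \<in> nonvanishing_weights Q x"
proof -
  let ?R = "monoid_algebra Q"
  interpret primeideal x ?R using assms(2) by (simp add: Spec_def)
  have open_iff: "x \<in> principal_open ?R f \<longleftrightarrow> f \<notin> x" if "f \<in> carrier ?R" for f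
    by (rule mem_principal_open_iff[OF assms(2) that])
  have zero: "0 \<in> carrier ?R" "0 \<in> x"
    using zero_closed additive_subgroup.zero_closed[OF is_additive_subgroup]
    by (simp_all add: monoid_algebra_def)
  show ?thesis
  proof (cases "w \<in> Q")
    case True
    have single: "Poly_Mapping.single w a \<in> carrier ?R" for a
      using True by (simp add: monoid_algebra_def)
    have const: "Poly_Mapping.single 0 a \<in> carrier ?R" for a
      using assms(1) by (simp add: monoid_algebra_def additive_submonoid_def)
    have "Poly_Mapping.single w a \<in> x" if "Poly_Mapping.single w 1 \<in> x" for a
      using I_l_closed[OF that const[of a]]
      by (simp add: monoid_algebra_def Poly_Mapping.mult_single)
    then show ?thesis
      using True open_iff[OF single]
      by (auto simp: monoid_algebra_grading_def nonvanishing_weights_def)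
  next
    case False
    then show ?thesis
      using open_iff[OF zero(1)] zero(2)
      by (simp add: monoid_algebra_grading_def nonvanishing_weights_def)
  qed
qed

lemma monoid_face_nonvanishing:
  assumes "additive_submonoid Q" and "x \<in> Spec (monoid_algebra Q)"
  shows "monoid_face Q (nonvanishing_weights Q x)"
proof -
  let ?R = "monoid_algebra Q"
  interpret primeideal x ?R using assms(2) by (simp add: Spec_def)
  have single: "Poly_Mapping.single w 1 \<in> carrier ?R" if "w \<in> Q" for w
    using that by (simp add: monoid_algebra_def)
  have mult: "Poly_Mapping.single (a + b) 1
      = Poly_Mapping.single a 1 \<otimes>\<^bsub>?R\<^esub> Poly_Mapping.single b 1" for a b
    by (simp add: monoid_algebra_def Poly_Mapping.mult_single)
  have "Poly_Mapping.single (a + b) 1 \<in> x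
      \<longleftrightarrow> Poly_Mapping.single a 1 \<in> x \<or> Poly_Mapping.single b 1 \<in> x"
    if "a \<in> Q" "b \<in> Q" for a b
    unfolding mult
    using I_prime[OF single single] I_l_closed[OF _ single] I_r_closed[OF _ single] that by metis
  \<comment> \<open>The character of \<open>0\<close> is the unit element, which no proper ideal contains.\<close>
  moreover have "Poly_Mapping.single 0 1 \<notin> x"
    using one_imp_carrier I_notcarr by (auto simp: monoid_algebra_def)
  ultimately show ?thesis
    using assms(1) unfolding monoid_face_def nonvanishing_weights_def additive_submonoid_def by auto
qed

definition character_eval :: "('v \<Rightarrow> complex) \<Rightarrow> ('v \<Rightarrow>\<^sub>0 complex) \<Rightarrow> complex" where
  "character_eval \<phi> f = (\<Sum>a\<in>Poly_Mapping.keys f. Poly_Mapping.lookup f a * \<phi> a)"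

lemma character_eval_superset:
  assumes "finite A" and "Poly_Mapping.keys f \<subseteq> A"
  shows "character_eval \<phi> f = (\<Sum>a\<in>A. Poly_Mapping.lookup f a * \<phi> a)"
  unfolding character_eval_def
  by (rule sum.mono_neutral_left) (use assms in \<open>auto simp: in_keys_iff\<close>)

lemma character_eval_single [simp]:
  "character_eval \<phi> (Poly_Mapping.single a c) = c * \<phi> a"
  by (simp add: character_eval_def)

lemma character_eval_zero [simp]: "character_eval \<phi> 0 = 0"
  by (simp add: character_eval_def)

lemma character_eval_add [simp]:
  "character_eval \<phi> (f + g) = character_eval \<phi> f + character_eval \<phi> g"
proof -
  let ?A = "Poly_Mapping.keys f \<union> Poly_Mapping.keys g"
  have "Poly_Mapping.keys (f + g) \<subseteq> ?A"
    by (rule Poly_Mapping.keys_add)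
  then show ?thesis
    by (simp add: character_eval_superset[of ?A] lookup_add distrib_right sum.distrib)
qed

lemma character_eval_sum:
  "character_eval \<phi> (\<Sum>i\<in>I. f i) = (\<Sum>i\<in>I. character_eval \<phi> (f i))"
  by (induction I rule: infinite_finite_induct) auto

lemma poly_mapping_eq_sum_single:
  "f = (\<Sum>a\<in>Poly_Mapping.keys f. Poly_Mapping.single a (Poly_Mapping.lookup f a))"
  by (rule poly_mapping_eqI) (auto simp: lookup_sum lookup_single when_def in_keys_iff)

lemma character_eval_mult:
  fixes f g :: "'v::ab_group_add \<Rightarrow>\<^sub>0 complex"
  assumes hom: "\<And>a b. a \<in> Q \<Longrightarrow> b \<in> Q \<Longrightarrow> \<phi> (a + b) = \<phi> a * \<phi> b"
    and f: "Poly_Mapping.keys f \<subseteq> Q" and g: "Poly_Mapping.keys g \<subseteq> Q"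
  shows "character_eval \<phi> (f * g) = character_eval \<phi> f * character_eval \<phi> g"
proof -
  let ?f = "Poly_Mapping.lookup f" and ?g = "Poly_Mapping.lookup g"
  have "f * g = (\<Sum>a\<in>Poly_Mapping.keys f. Poly_Mapping.single a (?f a))
      * (\<Sum>b\<in>Poly_Mapping.keys g. Poly_Mapping.single b (?g b))"
    using poly_mapping_eq_sum_single[of f] poly_mapping_eq_sum_single[of g] by simp
  also have "\<dots> = (\<Sum>a\<in>Poly_Mapping.keys f. \<Sum>b\<in>Poly_Mapping.keys g.
      Poly_Mapping.single (a + b) (?f a * ?g b))"
    by (simp add: sum_product Poly_Mapping.mult_single)
  finally have "character_eval \<phi> (f * g) = (\<Sum>a\<in>Poly_Mapping.keys f. \<Sum>b\<in>Poly_Mapping.keys g.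
      ?f a * ?g b * \<phi> (a + b))"
    by (simp add: character_eval_sum)
  also have "\<dots> = (\<Sum>a\<in>Poly_Mapping.keys f. \<Sum>b\<in>Poly_Mapping.keys g.
      (?f a * \<phi> a) * (?g b * \<phi> b))"
    by (intro sum.cong refl) (use hom f g in \<open>auto simp: subset_iff\<close>)
  finally show ?thesis
    by (simp add: character_eval_def sum_product)
qed

text \<open>
  Monoid homomorphisms from \<open>Q\<close> to the multiplicative monoid \<open>\<complex>\<close> are the complex-valued points
  of \<open>Spec \<complex>[Q]\<close>: the kernel of an evaluation is prime because \<open>\<complex>\<close> is a domain.
\<close>

lemma character_kernel_in_Spec:
  assumes "additive_submonoid Q" and one: "\<phi> 0 = 1"
    and hom: "\<And>a b. a \<in> Q \<Longrightarrow> b \<in> Q \<Longrightarrow> \<phi> (a + b) = \<phi> a * \<phi> b"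
  shows "{f. Poly_Mapping.keys f \<subseteq> Q \<and> character_eval \<phi> f = 0} \<in> Spec (monoid_algebra Q)"
    (is "?x \<in> Spec ?R")
proof -
  interpret R: cring ?R by (rule cring_monoid_algebra_submonoid) fact
  have carrier: "carrier ?R = {f. Poly_Mapping.keys f \<subseteq> Q}"
    and ops: "\<zero>\<^bsub>?R\<^esub> = 0" "\<one>\<^bsub>?R\<^esub> = 1" "a \<oplus>\<^bsub>?R\<^esub> b = a + b" "a \<otimes>\<^bsub>?R\<^esub> b = a * b" for a b
    by (simp_all add: monoid_algebra_def)
  have mult: "character_eval \<phi> (f * g) = character_eval \<phi> f * character_eval \<phi> g"
    if "f \<in> carrier ?R" "g \<in> carrier ?R" for f g
    using character_eval_mult[of Q \<phi> f g] hom that by (simp add: carrier)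
  have x: "?x = {f \<in> carrier ?R. character_eval \<phi> f = 0}"
    by (simp add: carrier)
  have closed: "f * g \<in> carrier ?R" if "f \<in> carrier ?R" "g \<in> carrier ?R" for f g
    using R.m_closed[OF that] by (simp add: ops)
  have inv: "\<ominus>\<^bsub>?R\<^esub> f \<in> ?x" if "f \<in> ?x" for f
  proof -
    have f: "f \<in> carrier ?R" "character_eval \<phi> f = 0" using that by (auto simp: carrier)
    have "f + \<ominus>\<^bsub>?R\<^esub> f = 0"
      using R.r_neg[OF f(1)] by (simp add: ops)
    then have "character_eval \<phi> f + character_eval \<phi> (\<ominus>\<^bsub>?R\<^esub> f) = 0"
      by (metis character_eval_add character_eval_zero)
    then show ?thesis
      using f R.a_inv_closed[OF f(1)] by (simp add: x)
  qed
  have "subgroup ?x (add_monoid ?R)"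
  proof (rule subgroup.intro)
    show "?x \<subseteq> carrier (add_monoid ?R)" by (auto simp: carrier)
    show "a \<otimes>\<^bsub>add_monoid ?R\<^esub> b \<in> ?x" if "a \<in> ?x" "b \<in> ?x" for a b
      using that R.a_closed[of a b] by (simp add: x ops)
    show "\<one>\<^bsub>add_monoid ?R\<^esub> \<in> ?x" by (simp add: ops)
    show "inv\<^bsub>add_monoid ?R\<^esub> a \<in> ?x" if "a \<in> ?x" for a
      using inv[OF that] by (simp add: a_inv_def)
  qed
  then have "ideal ?x ?R"
    by (intro idealI R.ring_axioms) (use closed mult in \<open>auto simp: x ops\<close>)
  moreover have "carrier ?R \<noteq> ?x"
  proof
    assume "carrier ?R = ?x"
    then have "character_eval \<phi> 1 = 0"
      using R.one_closed by (auto simp: ops)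
    then show False
      using character_eval_single[of \<phi> 0 1] one by simp
  qed
  moreover have "a \<in> ?x \<or> b \<in> ?x"
    if "a \<in> carrier ?R" "b \<in> carrier ?R" "a \<otimes>\<^bsub>?R\<^esub> b \<in> ?x" for a b
    using that mult[OF that(1,2)] by (simp add: x ops)
  ultimately have "primeideal ?x ?R"
    by (intro primeidealI R.cring_axioms) auto
  then show ?thesis by (simp add: Spec_def)
qed

text \<open>
  The indicator function of \<open>F\<close> is multiplicative exactly because \<open>F\<close> is a face; the resulting
  closed point is the distinguished point of the torus orbit attached to \<open>F\<close>.
\<close>

lemma face_attained:
  assumes "additive_submonoid Q" and "monoid_face Q F"
  obtains x where "x \<in> Spec (monoid_algebra Q)" and "nonvanishing_weights Q x = F"
proof
  let ?\<phi> = "\<lambda>a. if a \<in> F then 1 else 0 :: complex"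
  let ?x = "{f. Poly_Mapping.keys f \<subseteq> Q \<and> character_eval ?\<phi> f = 0}"
  show "?x \<in> Spec (monoid_algebra Q)"
    using assms(2) by (intro character_kernel_in_Spec assms(1)) (auto simp: monoid_face_def)
  show "nonvanishing_weights Q ?x = F"
    using assms(2) by (auto simp: nonvanishing_weights_def monoid_face_def)
qed

section \<open>Semistability and GIT-cones in terms of faces\<close>

text \<open>
  The positive multiples in the definition of semistability disappear because faces absorb roots.
\<close>

lemma semistable_monoid_algebra:
  assumes "vector_space scale" and "additive_submonoid Q" and "v \<in> Q"
  shows "semistable (monoid_algebra Q) scale (monoid_algebra_grading Q) v
         = {x \<in> Spec (monoid_algebra Q). v \<in> nonvanishing_weights Q x}"
    (is "?L = ?R")
proof -
  have "?L = {x \<in> Spec (monoid_algebra Q). \<exists>n>0.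
      \<exists>f\<in>monoid_algebra_grading Q (scale (of_nat n) v).
        x \<in> principal_open (monoid_algebra Q) f}"
    unfolding semistable_def principal_open_def by auto
  also have "\<dots> = {x \<in> Spec (monoid_algebra Q).
      \<exists>n>0. scale (of_nat n) v \<in> nonvanishing_weights Q x}"
    using exists_homogeneous_nonvanishing_iff[OF assms(2)] by (intro Collect_cong) metis
  also have "\<dots> = ?R"
    using monoid_face_scale_nat_iff[OF assms(1,2) monoid_face_nonvanishing[OF assms(2)] assms(3)]
      zero_less_one by blast
  finally show ?thesis .
qed

text \<open>
  The semistable points of \<open>v\<close> are those whose face contains \<open>smallest_face Q v\<close>, and this face
  itself belongs to one of them.
\<close>

lemma semistable_subset_iff:
  assumes "vector_space scale" and "additive_submonoid Q" and "v \<in> Q" and "w \<in> Q"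
  shows "semistable (monoid_algebra Q) scale (monoid_algebra_grading Q) v
           \<subseteq> semistable (monoid_algebra Q) scale (monoid_algebra_grading Q) w
         \<longleftrightarrow> w \<in> smallest_face Q v"
proof -
  obtain y where y: "y \<in> Spec (monoid_algebra Q)" "nonvanishing_weights Q y = smallest_face Q v"
    using face_attained assms(2) monoid_face_smallest_face[OF assms(2,3)] by metis
  have "smallest_face Q v \<subseteq> nonvanishing_weights Q x"
    if "x \<in> Spec (monoid_algebra Q)" "v \<in> nonvanishing_weights Q x" for x
    using smallest_face_subset monoid_face_nonvanishing assms(2) that by blast
  then show ?thesis
    unfolding semistable_monoid_algebra[OF assms(1-3)] semistable_monoid_algebra[OF assms(1,2,4)]
    using y mem_smallest_face[of v Q] by blast
qed

lemma orbit_cone_monoid_algebra: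
  assumes "additive_submonoid Q" and "Q \<subseteq> M" and "x \<in> Spec (monoid_algebra Q)"
  shows "orbit_cone (monoid_algebra Q) scale M (monoid_algebra_grading Q) x
         = convex_cone_gen scale (nonvanishing_weights Q x)"
proof -
  have "orbit_monoid (monoid_algebra Q) M (monoid_algebra_grading Q) x = nonvanishing_weights Q x"
    using assms(2) unfolding orbit_monoid_def exists_homogeneous_nonvanishing_iff[OF assms(1,3)]
    by (auto simp: nonvanishing_weights_def)
  then show ?thesis by (simp add: orbit_cone_def)
qed

text \<open>
  Having \<open>v\<close> in the orbit cone of \<open>x\<close> amounts to having it in the face of \<open>x\<close>, so the
  intersection runs over the cones of all faces containing \<open>v\<close>, the smallest one included.
\<close>

lemma git_cone_monoid_algebra:
  assumes "vector_space scale" and "additive_submonoid Q" and "Q \<subseteq> M" and "v \<in> Q"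
  shows "git_cone (monoid_algebra Q) scale M (monoid_algebra_grading Q) v
         = convex_cone_gen scale (smallest_face Q v)"
proof -
  let ?F = "nonvanishing_weights Q"
  have face: "monoid_face Q (?F x)" if "x \<in> Spec (monoid_algebra Q)" for x
    using monoid_face_nonvanishing assms(2) that by blast
  have "git_cone (monoid_algebra Q) scale M (monoid_algebra_grading Q) v
      = \<Inter>{convex_cone_gen scale (?F x) | x. x \<in> Spec (monoid_algebra Q) \<and> v \<in> ?F x}"
    unfolding git_cone_def
    by (intro arg_cong[of _ _ Inter] Collect_cong)
       (metis orbit_cone_monoid_algebra assms(2,3)
         mem_convex_cone_gen_face_iff[OF assms(1,2) _ assms(4)] face)
  also have "\<dots> = convex_cone_gen scale (smallest_face Q v)"
  proof
    obtain y where "y \<in> Spec (monoid_algebra Q)" "?F y = smallest_face Q v"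
      using face_attained assms(2) monoid_face_smallest_face[OF assms(2,4)] by metis
    then have "convex_cone_gen scale (smallest_face Q v)
        \<in> {convex_cone_gen scale (?F x) | x. x \<in> Spec (monoid_algebra Q) \<and> v \<in> ?F x}"
      using mem_smallest_face[of v Q] by (intro CollectI exI[of _ y]) simp
    then show "\<Inter>{convex_cone_gen scale (?F x) | x. x \<in> Spec (monoid_algebra Q) \<and> v \<in> ?F x}
        \<subseteq> convex_cone_gen scale (smallest_face Q v)"
      by (rule Inter_lower)
    show "convex_cone_gen scale (smallest_face Q v)
        \<subseteq> \<Inter>{convex_cone_gen scale (?F x) | x. x \<in> Spec (monoid_algebra Q) \<and> v \<in> ?F x}"
      using convex_cone_gen_mono smallest_face_subset face by (intro Inter_greatest) blast
  qed
  finally show ?thesis .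
qed

theorem lemma2:
  fixes scale :: "rat \<Rightarrow> 'v::ab_group_add \<Rightarrow> 'v"
    and M :: "'v set"
    and \<sigma> :: "('v \<Rightarrow> rat) set"
    and k :: nat
    and u :: "nat \<Rightarrow> 'v"
    and S :: "'v set"
  assumes "lattice_in scale M"
    and "rational_polyhedral_cone scale M \<sigma>"
    and "strongly_convex \<sigma>"
    and "inj_on u {1..k}"
    and "minimal_generating_set (u ` {1..k}) (dual_cone \<sigma> \<inter> M)"
    and "S = {\<Sum>i=1..k. scale (\<alpha> i) (u i) | \<alpha> :: nat \<Rightarrow> rat. \<forall>i\<in>{1..k}. \<alpha> i \<in> {0, 1}}"
    and "v \<in> S"
  shows "git_cone (toric_algebra M \<sigma>) scale M (toric_grading M \<sigma>) v =
         convex_cone_gen scale {u i | i. i \<in> {1..k} \<and> toric_weight_ge scale M \<sigma> v (u i)}"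
proof -
  define Q where "Q = dual_cone \<sigma> \<inter> M"
  have vs: "vector_space scale"
    using assms(1) unfolding lattice_in_def finite_dimensional_vector_space_def by blast
  interpret vector_space scale by (rule vs)
  have gen: "Q = submonoid_gen (u ` {1..k})"
    using assms(5) unfolding Q_def minimal_generating_set_def by simp
  have Q: "additive_submonoid Q"
    unfolding gen by (rule additive_submonoid_gen)
  have u: "u i \<in> Q" if "i \<in> {1..k}" for i
    unfolding gen using that by (blast intro: generator_in_submonoid_gen)
  have v: "v \<in> Q"
  proof -
    obtain \<alpha> :: "nat \<Rightarrow> rat" where \<alpha>: "\<forall>i\<in>{1..k}. \<alpha> i \<in> {0, 1}"
      and v_eq: "v = (\<Sum>i=1..k. scale (\<alpha> i) (u i))"
      using assms(6,7) by blast
    have "(\<Sum>i\<in>I. scale (\<alpha> i) (u i)) \<in> Q" if "finite I" "I \<subseteq> {1..k}" for I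
      using that
    proof induction
      case empty
      show ?case using Q by (simp add: additive_submonoid_def)
    next
      case (insert i I)
      then have "\<alpha> i = 0 \<or> \<alpha> i = 1"
        using \<alpha> by auto
      then have "scale (\<alpha> i) (u i) \<in> Q"
        using insert.prems u[of i] Q by (auto simp: additive_submonoid_def)
      with insert show ?case
        using Q by (simp add: additive_submonoid_def)
    qed
    then show ?thesis unfolding v_eq by simp
  qed
  have "git_cone (toric_algebra M \<sigma>) scale M (toric_grading M \<sigma>) v
      = convex_cone_gen scale (smallest_face Q v)"
    unfolding toric_algebra_def toric_grading_def Q_def[symmetric]
    by (rule git_cone_monoid_algebra[OF vs Q _ v]) (simp add: Q_def)
  also have "\<dots> = convex_cone_gen scale (u ` {1..k} \<inter> smallest_face Q v)"
    using convex_cone_gen_face[OF vs] monoid_face_smallest_face[OF Q v] unfolding gen by blast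
  also have "u ` {1..k} \<inter> smallest_face Q v
      = {u i | i. i \<in> {1..k} \<and> toric_weight_ge scale M \<sigma> v (u i)}"
    using semistable_subset_iff[OF vs Q v u]
    unfolding toric_weight_ge_def toric_algebra_def toric_grading_def Q_def[symmetric] by blast
  finally show ?thesis .
qed

end
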